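(* Let $V$ be a complex Hilbert space and $S$ a densely defined symmetric operator on $V$. Then a boundary quadruple $(H_-,H_+,G_-,G_+)$ for $S$ always exists. Moreover, for every boundary quadruple $(H_-,H_+,G_-,G_+)$ for $S$, the spaces $H_-$ and $H_+$ are complete and $G_-,G_+$ are continuous when $D(S^* )$ carries the graph norm.
   Context: Inner products are linear in the first argument. An operator on $V$ is a linear map defined on a linear subspace (its domain) of $V$ with values in $V$. $S$ is symmetric if $\langle Su,v\rangle_V=\langle u,Sv\rangle_V$ for all $u,v\in D(S)$. A boundary quadruple $(H_-,H_+,G_-,G_+)$ for $S$ consists of complex pre-Hilbert spaces $H_-,H_+$ and surjective linear maps $G_-:D(S^* )\to H_-$, $G_+:D(S^* )\to H_+$ such that $\langle S^*u,v\rangle_V-\langle u,S^*v\rangle_V=i\left(\langle G_-u,G_-v\rangle_{H_-}-\langle G_+u,G_+v\rangle_{H_+}\right)$ for all $u,v\in D(S^* )$, and $\ker G_++\ker G_-=D(S^* )$. The graph norm on $D(S^* )$ is $\left(\|u\|_V^2+\|S^*u\|_V^2\right)^{1/2}$. *)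

theory Defs
  imports "HOL-Analysis.Analysis"
begin

text \<open>Complex pre-Hilbert spaces and complex Hilbert spaces. The inner product is linear in the
  first argument. Building on \<^class>\<open>real_normed_vector\<close> makes the topological and metric notions
  of the library refer to the norm \<open>sqrt (Re (cinner x x))\<close>.\<close>

class complex_inner = real_normed_vector +
  fixes scaleC :: "complex \<Rightarrow> 'a \<Rightarrow> 'a" (infixr "*\<^sub>C" 75)
    and cinner :: "'a \<Rightarrow> 'a \<Rightarrow> complex"
  assumes scaleR_scaleC: "scaleR r x = complex_of_real r *\<^sub>C x"
    and scaleC_add_right: "a *\<^sub>C (x + y) = a *\<^sub>C x + a *\<^sub>C y"
    and scaleC_add_left: "(a + b) *\<^sub>C x = a *\<^sub>C x + b *\<^sub>C x"
    and scaleC_scaleC: "a *\<^sub>C b *\<^sub>C x = (a * b) *\<^sub>C x"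
    and scaleC_one: "1 *\<^sub>C x = x"
    and cinner_commute: "cinner x y = cnj (cinner y x)"
    and cinner_add_left: "cinner (x + y) z = cinner x z + cinner y z"
    and cinner_scaleC_left: "cinner (a *\<^sub>C x) y = a * cinner x y"
    and cinner_self_nonneg: "0 \<le> Re (cinner x x)"
    and cinner_self_eq_0_iff: "cinner x x = 0 \<longleftrightarrow> x = 0"
    and norm_eq_sqrt_cinner: "norm x = sqrt (Re (cinner x x))"

class complex_hilbert = complex_inner + complete_space

instantiation complex :: complex_hilbert
begin
definition scaleC_complex :: "complex \<Rightarrow> complex \<Rightarrow> complex" where
  "scaleC_complex a x = a * x"
definition cinner_complex :: "complex \<Rightarrow> complex \<Rightarrow> complex" where
  "cinner_complex x y = x * cnj y"
instance
  by standard
    (simp_all add: scaleC_complex_def cinner_complex_def scaleR_conv_of_real algebra_simps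
      cmod_def power2_eq_square)
end

global_interpretation complex_vector:
  vector_space "scaleC :: complex \<Rightarrow> 'a \<Rightarrow> 'a::complex_inner"
  by unfold_locales (fact scaleC_add_right scaleC_add_left scaleC_scaleC scaleC_one)+

text \<open>A partially defined map is a pair of a domain \<open>D\<close> and a total function whose values outside
  \<open>D\<close> are irrelevant.\<close>

definition clinear_on :: "'a::complex_inner set \<Rightarrow> ('a \<Rightarrow> 'b::complex_inner) \<Rightarrow> bool" where
  "clinear_on D f \<longleftrightarrow>
     (\<forall>x\<in>D. \<forall>y\<in>D. f (x + y) = f x + f y) \<and> (\<forall>c. \<forall>x\<in>D. f (c *\<^sub>C x) = c *\<^sub>C f x)"

definition ker_on :: "'a set \<Rightarrow> ('a \<Rightarrow> 'b::zero) \<Rightarrow> 'a set" where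
  "ker_on D f = {u \<in> D. f u = 0}"

definition linear_operator :: "'a::complex_inner set \<Rightarrow> ('a \<Rightarrow> 'a) \<Rightarrow> bool" where
  "linear_operator D S \<longleftrightarrow> complex_vector.subspace D \<and> clinear_on D S"

definition densely_defined :: "'a::complex_inner set \<Rightarrow> bool" where
  "densely_defined D \<longleftrightarrow> closure D = UNIV"

definition symmetric_operator :: "'a::complex_inner set \<Rightarrow> ('a \<Rightarrow> 'a) \<Rightarrow> bool" where
  "symmetric_operator D S \<longleftrightarrow>
     linear_operator D S \<and> (\<forall>u\<in>D. \<forall>v\<in>D. cinner (S u) v = cinner u (S v))"

definition adj_dom :: "'a::complex_inner set \<Rightarrow> ('a \<Rightarrow> 'a) \<Rightarrow> 'a set" where
  "adj_dom D S = {v. \<exists>w. \<forall>u\<in>D. cinner (S u) v = cinner u w}"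

definition adj :: "'a::complex_inner set \<Rightarrow> ('a \<Rightarrow> 'a) \<Rightarrow> 'a \<Rightarrow> 'a" where
  "adj D S v = (THE w. \<forall>u\<in>D. cinner (S u) v = cinner u w)"

text \<open>For a densely defined operator the description in \<open>adj\<close> is unique.\<close>

lemma cinner_diff_right: "cinner x (y - z) = cinner x y - cinner x (z::'a::complex_inner)"
proof -
  have "cinner (y - z) x = cinner y x - cinner z x"
    using cinner_add_left[of "y - z" z x] by simp
  then show ?thesis
    by (metis cinner_commute complex_cnj_diff)
qed

lemma Re_cinner_polarization:
  "Re (cinner x y) = ((norm (x + y))\<^sup>2 - (norm x)\<^sup>2 - (norm (y::'a::complex_inner))\<^sup>2) / 2"
proof -
  have norm2: "(norm z)\<^sup>2 = Re (cinner z z)" for z :: 'a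
    by (simp add: norm_eq_sqrt_cinner cinner_self_nonneg)
  have "cinner (x + y) (x + y) = cinner x (x + y) + cinner y (x + y)"
    by (rule cinner_add_left)
  also have "\<dots> = cnj (cinner x x + cinner y x) + cnj (cinner x y + cinner y y)"
    by (metis cinner_add_left cinner_commute)
  finally have "Re (cinner (x + y) (x + y))
      = Re (cinner x x) + Re (cinner y x) + Re (cinner x y) + Re (cinner y y)"
    by simp
  moreover have "Re (cinner y x) = Re (cinner x y)"
    by (subst cinner_commute) simp
  ultimately show ?thesis
    by (simp add: norm2)
qed

lemma adj_eqI:
  fixes S :: "'a::complex_inner \<Rightarrow> 'a"
  assumes "densely_defined D" and w: "\<forall>u\<in>D. cinner (S u) v = cinner u w"
  shows "adj D S v = w"
  unfolding adj_def
proof (rule the_equality[where a = w])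
  fix w' assume w': "\<forall>u\<in>D. cinner (S u) v = cinner u w'"
  let ?z = "w' - w"
  let ?Z = "{u. Re (cinner u ?z) = 0}"
  have "closed ?Z"
    unfolding Re_cinner_polarization by (intro closed_Collect_eq continuous_intros) auto
  moreover have "D \<subseteq> ?Z"
    using w w' by (auto simp: cinner_diff_right)
  ultimately have "?z \<in> ?Z"
    using assms(1) closure_minimal[of D ?Z] unfolding densely_defined_def by blast
  then have "norm ?z = 0"
    by (simp add: norm_eq_sqrt_cinner)
  then show "w' = w" by simp
qed (use w in blast)

definition graph_norm :: "'a::complex_inner set \<Rightarrow> ('a \<Rightarrow> 'a) \<Rightarrow> 'a \<Rightarrow> real" where
  "graph_norm D S u = sqrt ((norm u)\<^sup>2 + (norm (adj D S u))\<^sup>2)"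

definition graph_topology :: "'a::complex_inner set \<Rightarrow> ('a \<Rightarrow> 'a) \<Rightarrow> 'a topology" where
  "graph_topology D S = Metric_space.mtopology (adj_dom D S) (\<lambda>u v. graph_norm D S (u - v))"

text \<open>\<open>graph_norm\<close> indeed induces a metric on the domain of the adjoint, so that
  \<open>graph_topology\<close> is the corresponding metric topology.\<close>

lemma Metric_space_graph_norm:
  fixes S :: "'a::complex_inner \<Rightarrow> 'a"
  assumes dd: "densely_defined D"
  shows "Metric_space (adj_dom D S) (\<lambda>u v. graph_norm D S (u - v))"
proof -
  have eq: "graph_norm D S (u - v) = dist (u, adj D S u) (v, adj D S v)"
    if u: "u \<in> adj_dom D S" and v: "v \<in> adj_dom D S" for u v
  proof -
    obtain w1 w2 where w: "\<forall>x\<in>D. cinner (S x) u = cinner x w1" "\<forall>x\<in>D. cinner (S x) v = cinner x w2"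
      using u v by (auto simp: adj_dom_def)
    then have "adj D S (u - v) = adj D S u - adj D S v"
      using adj_eqI[OF dd w(1)] adj_eqI[OF dd w(2)]
      by (intro adj_eqI[OF dd]) (simp add: cinner_diff_right)
    then show ?thesis
      by (simp add: graph_norm_def dist_norm norm_Pair)
  qed
  have nonneg: "0 \<le> graph_norm D S u" for u
    by (simp add: graph_norm_def)
  \<comment> \<open>\<open>Metric_space\<close> demands symmetry also outside the carrier.\<close>
  have sym: "graph_norm D S (u - v) = graph_norm D S (v - u)" for u v
  proof -
    have neg: "cinner x (- y) = - cinner x y" for x y :: 'a
      using cinner_diff_right[of x 0 y] cinner_diff_right[of x 0 0] by simp
    have "norm (adj D S (- y)) = norm (adj D S y)" for y
    proof (cases "y \<in> adj_dom D S")
      case True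
      then obtain w where w: "\<forall>x\<in>D. cinner (S x) y = cinner x w"
        by (auto simp: adj_dom_def)
      then have "\<forall>x\<in>D. cinner (S x) (- y) = cinner x (- w)"
        by (simp add: neg)
      then show ?thesis
        using adj_eqI[OF dd w] adj_eqI[OF dd] by fastforce
    next
      case False
      then have no: "\<not> (\<forall>x\<in>D. cinner (S x) y = cinner x w)" for w
        by (auto simp: adj_dom_def)
      then have no': "\<not> (\<forall>x\<in>D. cinner (S x) (- y) = cinner x w)" for w
        using no[of "- w"] by (metis neg add.inverse_inverse)
      show ?thesis
        unfolding adj_def by (simp only: no no')
    qed
    from this[of "v - u"] show ?thesis
      by (simp add: graph_norm_def norm_minus_commute)
  qed
  show ?thesis
  proof
    fix x y z assume "x \<in> adj_dom D S" "y \<in> adj_dom D S" "z \<in> adj_dom D S"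
    then show "graph_norm D S (x - z) \<le> graph_norm D S (x - y) + graph_norm D S (y - z)"
      by (simp only: eq dist_triangle)
  qed (auto simp: nonneg sym eq)
qed

text \<open>\<open>Hm\<close> and \<open>Hp\<close> are linear subspaces of ambient pre-Hilbert types, carrying the restricted
  inner product; every complex pre-Hilbert space arises this way.\<close>

definition boundary_quadruple ::
  "'a::complex_inner set \<Rightarrow> ('a \<Rightarrow> 'a) \<Rightarrow> 'b::complex_inner set \<Rightarrow> 'c::complex_inner set
    \<Rightarrow> ('a \<Rightarrow> 'b) \<Rightarrow> ('a \<Rightarrow> 'c) \<Rightarrow> bool" where
  "boundary_quadruple D S Hm Hp Gm Gp \<longleftrightarrow>
     complex_vector.subspace Hm \<and> complex_vector.subspace Hp \<and>
     clinear_on (adj_dom D S) Gm \<and> Gm ` adj_dom D S = Hm \<and>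
     clinear_on (adj_dom D S) Gp \<and> Gp ` adj_dom D S = Hp \<and>
     (\<forall>u\<in>adj_dom D S. \<forall>v\<in>adj_dom D S.
        cinner (adj D S u) v - cinner u (adj D S v)
          = \<i> * (cinner (Gm u) (Gm v) - cinner (Gp u) (Gp v))) \<and>
     {x + y |x y. x \<in> ker_on (adj_dom D S) Gp \<and> y \<in> ker_on (adj_dom D S) Gm} = adj_dom D S"

end

theory Submission
  imports Defs
begin

text \<open>With \<open>J (x, y) = (y, - x)\<close> on \<open>V \<times> V\<close>, the boundary form is \<open>\<langle>J u, v\<rangle>\<close> on the graph \<open>A\<close> of
  \<open>S\<^sup>*\<close>, the graph norm is the norm of \<open>V \<times> V\<close>, and \<open>A\<close> is the orthogonal complement of \<open>J \<Gamma>\<close>, where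
  \<open>\<Gamma> \<subseteq> A\<close> is the closure of the graph of \<open>S\<close>. The form vanishes when one argument lies in \<open>\<Gamma>\<close>, and
  \<open>J\<close> maps \<open>A \<inter> \<Gamma>\<^sup>\<bottom>\<close> into itself.

  Existence: if \<open>(p, q)\<close> is the part of \<open>(u, S\<^sup>* u)\<close> orthogonal to \<open>\<Gamma>\<close>, then
  \<open>(p \<mp> i q) / \<surd>2\<close> are boundary maps (these are its components in the deficiency spaces).

  Continuity: every \<open>h\<close> in the range of \<open>G\<^sub>-\<close> is \<open>G\<^sub>- v\<close> with \<open>G\<^sub>+ v = 0\<close>, so Green's identity makes
  \<open>u \<mapsto> \<langle>G\<^sub>- u, h\<rangle>\<close> continuous, and uniform boundedness applies. Completeness: one can also take
  \<open>v \<bottom> \<Gamma>\<close>, and then \<open>\<parallel>v\<parallel>\<^sup>2 = \<bar>\<langle>G\<^sub>- (J v), h\<rangle>\<bar> \<le> C \<parallel>v\<parallel> \<parallel>h\<parallel>\<close>, so Cauchy sequences lift to the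
  complete graph.\<close>

section \<open>Complex inner product spaces\<close>

lemma cinner_scaleC_right: "cinner x (a *\<^sub>C y) = cnj a * cinner x (y::'a::complex_inner)"
  by (metis cinner_commute cinner_scaleC_left complex_cnj_mult)

lemma cinner_add_right: "cinner x (y + z) = cinner x y + cinner x (z::'a::complex_inner)"
  by (metis cinner_commute cinner_add_left complex_cnj_add)

lemma Im_cinner_self: "Im (cinner x x) = 0"
  using cinner_commute[of x x] by (metis Im_complex_of_real complex_cnj_cancel_iff Reals_cnj_iff complex_is_Real_iff)

lemma cinner_self: "cinner x x = complex_of_real ((norm x)\<^sup>2)"
  by (simp add: complex_eq_iff Im_cinner_self norm_eq_sqrt_cinner cinner_self_nonneg)

lemma norm_scaleC: "norm (a *\<^sub>C x) = cmod a * norm (x::'a::complex_inner)"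
proof -
  have "complex_of_real ((norm (a *\<^sub>C x))\<^sup>2) = a * cnj a * cinner x x"
    by (simp only: cinner_self[symmetric] cinner_scaleC_left cinner_scaleC_right ac_simps)
  also have "\<dots> = complex_of_real ((cmod a * norm x)\<^sup>2)"
    by (simp add: cinner_self complex_norm_square[symmetric] power_mult_distrib)
  finally show ?thesis
    unfolding of_real_eq_iff by (rule power2_eq_imp_eq) simp_all
qed

text \<open>The triangle inequality belongs to the type class, so Cauchy-Schwarz for real parts
  follows from it by polarization, the reverse of the usual order.\<close>

lemma Re_cinner_le_norm: "Re (cinner x y) \<le> norm x * norm y"
proof -
  have "(norm (x + y))\<^sup>2 \<le> (norm x + norm y)\<^sup>2"
    by (intro power_mono norm_triangle_ineq) simp
  then show ?thesis
    by (simp add: Re_cinner_polarization power2_sum)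
qed

lemma cmod_cinner_le_norm: "cmod (cinner x y) \<le> norm x * norm y"
proof -
  \<comment> \<open>\<open>a\<close> is the phase that turns the inner product into its modulus.
    Since \<open>sgn 0 = 0\<close>, it is 0 in the degenerate case, hence the inequality in the last
    estimate.\<close>
  define a where "a = cnj (sgn (cinner x y))"
  have "a * cinner x y = cinner x y * cnj (cinner x y) / complex_of_real (cmod (cinner x y))"
    by (simp add: a_def sgn_eq)
  also have "\<dots> = complex_of_real (cmod (cinner x y))"
    by (simp only: complex_norm_square[symmetric] power2_eq_square of_real_mult
        nonzero_mult_div_cancel_right) (cases "cinner x y = 0"; simp)
  finally have "a * cinner x y = complex_of_real (cmod (cinner x y))" .
  then have "cmod (cinner x y) = Re (cinner (a *\<^sub>C x) y)"
    by (simp add: cinner_scaleC_left)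
  also have "\<dots> \<le> cmod a * norm x * norm y"
    using Re_cinner_le_norm[of "a *\<^sub>C x" y] by (simp add: norm_scaleC)
  also have "\<dots> \<le> norm x * norm y"
    by (simp add: a_def norm_sgn)
  finally show ?thesis .
qed

text \<open>A sesquilinear form is bilinear over the reals, so the library theory of bounded
  bilinear maps supplies limits, continuity and the sign and zero rules in both arguments.\<close>

global_interpretation cinner: bounded_bilinear "cinner :: 'a::complex_inner \<Rightarrow> 'a \<Rightarrow> complex"
proof
  show "\<exists>K. \<forall>(a::'a) b. cmod (cinner a b) \<le> norm a * norm b * K"
    using cmod_cinner_le_norm by (metis mult.right_neutral)
qed (simp_all add: cinner_add_left cinner_add_right scaleR_scaleC cinner_scaleC_left
    cinner_scaleC_right scaleC_complex_def scaleR_conv_of_real)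

lemma norm_diff_sq:
  "(norm (x - y))\<^sup>2 = (norm x)\<^sup>2 - 2 * Re (cinner x y) + (norm (y::'a::complex_inner))\<^sup>2"
  using Re_cinner_polarization[of x "- y"] by (simp add: cinner.minus_right)

lemma norm_add_sq:
  "(norm (x + y))\<^sup>2 = (norm x)\<^sup>2 + 2 * Re (cinner x y) + (norm (y::'a::complex_inner))\<^sup>2"
  by (simp add: Re_cinner_polarization field_simps)

lemma parallelogram_law:
  "(norm (x + y))\<^sup>2 + (norm (x - y))\<^sup>2 = 2 * (norm x)\<^sup>2 + 2 * (norm (y::'a::complex_inner))\<^sup>2"
  by (simp add: norm_add_sq norm_diff_sq)

lemma clinear_on_diff:
  assumes "clinear_on D f" "complex_vector.subspace D" "x \<in> D" "y \<in> D"
  shows "f (x - y) = f x - f y"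
  using assms complex_vector.subspace_diff[OF assms(2-4)]
  unfolding clinear_on_def by (metis diff_add_cancel eq_diff_eq)

lemma clinear_on_zero:
  assumes "clinear_on D f" "complex_vector.subspace D"
  shows "f 0 = 0"
  using clinear_on_diff[OF assms, of 0 0] complex_vector.subspace_0[OF assms(2)] by simp

lemma subspace_clinear_image:
  assumes f: "clinear_on D f" and D: "complex_vector.subspace D"
  shows "complex_vector.subspace (f ` D)"
proof (rule complex_vector.subspaceI)
  show "0 \<in> f ` D"
    using clinear_on_zero[OF f D] complex_vector.subspace_0[OF D] by (metis imageI)
  show "x + y \<in> f ` D" if xy: "x \<in> f ` D" "y \<in> f ` D" for x y
  proof -
    obtain a b where "a \<in> D" "b \<in> D" "x = f a" "y = f b"
      using xy by blast
    then show ?thesis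
      using f complex_vector.subspace_add[OF D] unfolding clinear_on_def by (intro image_eqI[of _ _ "a + b"]) simp_all
  qed
  show "c *\<^sub>C x \<in> f ` D" if x: "x \<in> f ` D" for c x
  proof -
    obtain a where "a \<in> D" "x = f a"
      using x by blast
    then show ?thesis
      using f complex_vector.subspace_scale[OF D] unfolding clinear_on_def by (intro image_eqI[of _ _ "c *\<^sub>C a"]) simp_all
  qed
qed

lemma subspace_closure:
  fixes D :: "'a::complex_inner set"
  assumes D: "complex_vector.subspace D"
  shows "complex_vector.subspace (closure D)"
proof (rule complex_vector.subspaceI)
  show "0 \<in> closure D"
    using closure_subset complex_vector.subspace_0[OF D] by blast
  show "x + y \<in> closure D" if xy: "x \<in> closure D" "y \<in> closure D" for x y
  proof -
    obtain a b where "\<forall>n. a n \<in> D" "a \<longlonglongrightarrow> x" "\<forall>n. b n \<in> D" "b \<longlonglongrightarrow> y"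
      using xy unfolding closure_sequential by blast
    then show ?thesis
      unfolding closure_sequential
      by (intro exI[of _ "\<lambda>n. a n + b n"])
         (auto intro: tendsto_add complex_vector.subspace_add[OF D])
  qed
  show "c *\<^sub>C x \<in> closure D" if x: "x \<in> closure D" for c x
  proof -
    obtain a where a: "\<forall>n. a n \<in> D" "a \<longlonglongrightarrow> x"
      using x unfolding closure_sequential by blast
    have "bounded_linear (\<lambda>y::'a. c *\<^sub>C y)"
      by (rule bounded_linear_intro[where K = "cmod c"])
         (simp_all add: scaleC_add_right scaleR_scaleC scaleC_scaleC norm_scaleC mult.commute)
    from bounded_linear.tendsto[OF this a(2)] show ?thesis
      unfolding closure_sequential using a(1)
      by (intro exI[of _ "\<lambda>n. c *\<^sub>C a n"]) (auto intro: complex_vector.subspace_scale[OF D])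
  qed
qed

section \<open>The Hilbert space of pairs\<close>

instantiation prod :: (complex_inner, complex_inner) complex_inner
begin
definition scaleC_prod :: "complex \<Rightarrow> 'a \<times> 'b \<Rightarrow> 'a \<times> 'b" where
  "scaleC_prod c x = (c *\<^sub>C fst x, c *\<^sub>C snd x)"
text \<open>The library norm on pairs is the Euclidean one, which forces this sum; completeness of
  the product is then already available.\<close>

definition cinner_prod :: "'a \<times> 'b \<Rightarrow> 'a \<times> 'b \<Rightarrow> complex" where
  "cinner_prod x y = cinner (fst x) (fst y) + cinner (snd x) (snd y)"
instance
proof
  fix x y :: "'a \<times> 'b"
  show "cinner x y = cnj (cinner y x)"
    by (simp add: cinner_prod_def flip: cinner_commute)
  show "cinner x x = 0 \<longleftrightarrow> x = 0"
    unfolding cinner_prod_def cinner_self of_real_add[symmetric] of_real_eq_0_iff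
    by (simp add: prod_eq_iff add_nonneg_eq_0_iff)
  show "norm x = sqrt (Re (cinner x x))"
    by (simp add: cinner_prod_def cinner_self norm_prod_def)
qed (simp_all add: scaleC_prod_def cinner_prod_def prod_eq_iff scaleR_scaleC scaleC_add_right
    scaleC_add_left scaleC_scaleC scaleC_one cinner_add_left cinner_scaleC_left
    cinner_self_nonneg algebra_simps)
end

instance prod :: (complex_hilbert, complex_hilbert) complex_hilbert ..

lemma scaleC_Pair [simp]: "c *\<^sub>C (a, b) = (c *\<^sub>C a, c *\<^sub>C b)"
  by (simp add: scaleC_prod_def)

lemma cinner_Pair [simp]: "cinner (a, b) (c, d) = cinner a c + cinner b d"
  by (simp add: cinner_prod_def)

section \<open>Orthogonal projection and uniform boundedness\<close>

lemma nearest_point_orthogonal: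
  fixes M :: "'a::complex_inner set"
  assumes M: "complex_vector.subspace M" and y: "y \<in> M" and z: "z \<in> M"
    and min: "\<And>y'. y' \<in> M \<Longrightarrow> norm (x - y) \<le> norm (x - y')"
  shows "cinner (x - y) z = 0"
proof (cases "z = 0")
  case False
  define c where "c = cinner (x - y) z"
  \<comment> \<open>The optimal perturbation: \<open>t\<close> is the coefficient of the projection
    of \<open>x - y\<close> onto \<open>z\<close>, and moving \<open>y\<close> by it lowers the
    squared distance by exactly \<open>(cmod c)\<^sup>2 / (norm z)\<^sup>2\<close>.\<close>
  define t where "t = c / complex_of_real ((norm z)\<^sup>2)"
  have cmod_t: "cmod t = cmod c / (norm z)\<^sup>2"
    by (simp add: t_def norm_divide del: of_real_power)
  have "norm (x - y) \<le> norm (x - (y + t *\<^sub>C z))"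
    by (intro min complex_vector.subspace_add[OF M y] complex_vector.subspace_scale[OF M z])
  then have "(norm (x - y))\<^sup>2 \<le> (norm (x - y - t *\<^sub>C z))\<^sup>2"
    by (simp add: diff_diff_eq)
  also have "\<dots> = (norm (x - y))\<^sup>2 - 2 * Re (cnj t * c) + (cmod t)\<^sup>2 * (norm z)\<^sup>2"
    by (simp add: norm_diff_sq[of "x - y"] cinner_scaleC_right norm_scaleC c_def power_mult_distrib)
  also have "cnj t * c = complex_of_real ((cmod c)\<^sup>2 / (norm z)\<^sup>2)"
    by (simp add: t_def complex_norm_square mult.commute del: of_real_power)
  also have "(cmod t)\<^sup>2 * (norm z)\<^sup>2 = (cmod c)\<^sup>2 / (norm z)\<^sup>2"
    using False by (simp add: cmod_t power2_eq_square)
  finally have "(cmod c)\<^sup>2 / (norm z)\<^sup>2 \<le> 0"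
    by simp
  then show ?thesis
    using False by (simp add: c_def divide_le_0_iff)
qed (simp add: cinner.zero_right)

text \<open>A minimizing sequence for the distance from \<open>x\<close> is Cauchy by the
  parallelogram law, and its limit is the nearest point, hence the foot of the
  perpendicular.\<close>

lemma ex_orthogonal_decomposition:
  fixes M :: "'a::complex_hilbert set"
  assumes M: "complex_vector.subspace M" and "closed M"
  obtains y where "y \<in> M" and "\<And>z. z \<in> M \<Longrightarrow> cinner (x - y) z = 0"
proof -
  define d where "d = (INF y\<in>M. (norm (x - y))\<^sup>2)"
  have ne: "M \<noteq> {}"
    using complex_vector.subspace_0[OF M] by blast
  have bdd: "bdd_below ((\<lambda>y. (norm (x - y))\<^sup>2) ` M)"
    by (rule bdd_belowI2[where m = 0]) simp
  have d_le: "d \<le> (norm (x - y))\<^sup>2" if "y \<in> M" for y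
    unfolding d_def by (rule cINF_lower[OF bdd that])
  have "\<exists>y\<in>M. (norm (x - y))\<^sup>2 < d + e" if "e > 0" for e
    using cINF_less_iff[OF ne bdd, of "d + e"] that by (simp add: d_def)
  then have "\<forall>n. \<exists>y. y \<in> M \<and> (norm (x - y))\<^sup>2 < d + inverse (real (Suc n))"
    by (metis inverse_positive_iff_positive of_nat_0_less_iff zero_less_Suc)
  then obtain s where s: "\<And>n. s n \<in> M" "\<And>n. (norm (x - s n))\<^sup>2 < d + inverse (real (Suc n))"
    by metis
  have s_diff: "(norm (s m - s n))\<^sup>2 \<le> 2 * (inverse (real (Suc m)) + inverse (real (Suc n)))"
    for m n
  proof -
    \<comment> \<open>The midpoint of two approximants stays in \<open>M\<close>, so its squared
      distance to \<open>x\<close> is at least \<open>d\<close>; the parallelogram law then forces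
      the approximants together.\<close>
    let ?h = "(1/2) *\<^sub>R (s m + s n)"
    have "?h \<in> M"
      using s(1) by (simp add: scaleR_scaleC complex_vector.subspace_add[OF M]
          complex_vector.subspace_scale[OF M])
    moreover have "(x - s m) + (x - s n) = 2 *\<^sub>R (x - ?h)"
      by (simp add: scaleR_right_diff_distrib scaleR_2)
    then have "(norm ((x - s m) + (x - s n)))\<^sup>2 = 4 * (norm (x - ?h))\<^sup>2"
      by (simp add: power_mult_distrib)
    moreover have "(x - s n) - (x - s m) = s m - s n"
      by simp
    ultimately show ?thesis
      using d_le[of ?h] s(2)[of m] s(2)[of n] parallelogram_law[of "x - s n" "x - s m"]
      by (simp add: add.commute)
  qed
  have "Cauchy s"
  proof (rule metric_CauchyI)
    fix e :: real assume "e > 0"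
    then obtain N where N: "inverse (real (Suc N)) < e\<^sup>2 / 4"
      using reals_Archimedean[of "e\<^sup>2 / 4"] by auto
    have "dist (s m) (s n) < e" if "m \<ge> N" "n \<ge> N" for m n
    proof -
      have "inverse (real (Suc m)) \<le> inverse (real (Suc N))"
        "inverse (real (Suc n)) \<le> inverse (real (Suc N))"
        using that by (auto intro!: le_imp_inverse_le)
      then have "2 * (inverse (real (Suc m)) + inverse (real (Suc n))) \<le> 2 * (2 * inverse (real (Suc N)))"
        by (simp only: mult_2[of "inverse (real (Suc N))"] add_mono mult_left_mono)
      also have "\<dots> < e\<^sup>2"
        using N by simp
      finally have "(norm (s m - s n))\<^sup>2 < e\<^sup>2"
        using s_diff[of m n] by (rule le_less_trans[rotated])
      then show ?thesis
        using \<open>e > 0\<close> by (simp add: dist_norm power_less_imp_less_base)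
    qed
    then show "\<exists>N. \<forall>m\<ge>N. \<forall>n\<ge>N. dist (s m) (s n) < e"
      by blast
  qed
  then obtain y where y: "s \<longlonglongrightarrow> y"
    using Cauchy_convergent convergent_def by blast
  then have "y \<in> M"
    using \<open>closed M\<close> s(1) closed_sequentially by blast
  have "(norm (x - y))\<^sup>2 \<le> d"
  proof (rule LIMSEQ_le)
    show "(\<lambda>n. (norm (x - s n))\<^sup>2) \<longlonglongrightarrow> (norm (x - y))\<^sup>2"
      by (intro tendsto_intros y)
    show "(\<lambda>n. d + inverse (real (Suc n))) \<longlonglongrightarrow> d"
      using tendsto_add[OF tendsto_const LIMSEQ_inverse_real_of_nat, of d] by simp
    show "\<exists>N. \<forall>n\<ge>N. (norm (x - s n))\<^sup>2 \<le> d + inverse (real (Suc n))"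
      using s(2) less_imp_le by blast
  qed
  then have "norm (x - y) \<le> norm (x - y')" if "y' \<in> M" for y'
    using d_le[OF that] by (meson norm_ge_zero order_trans power2_le_imp_le)
  then show thesis
    using that nearest_point_orthogonal[OF M \<open>y \<in> M\<close>] \<open>y \<in> M\<close> by blast
qed

text \<open>The component of \<open>x\<close> orthogonal to \<open>M\<close>, so that
  \<open>x - perp_part M x\<close> is the usual projection onto \<open>M\<close>. The description
  determines a value whenever \<open>M\<close> is a closed subspace of a Hilbert space.\<close>

definition perp_part :: "'a::complex_inner set \<Rightarrow> 'a \<Rightarrow> 'a" where
  "perp_part M x = (THE p. x - p \<in> M \<and> (\<forall>z\<in>M. cinner p z = 0))"

text \<open>Two candidates differ by an element of \<open>M\<close> that is orthogonal to
  \<open>M\<close>, hence to itself.\<close>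

lemma perp_part_eqI:
  assumes M: "complex_vector.subspace M" and p: "x - p \<in> M" "\<And>z. z \<in> M \<Longrightarrow> cinner p z = 0"
  shows "perp_part M x = p"
  unfolding perp_part_def
proof (rule the_equality)
  fix q assume q: "x - q \<in> M \<and> (\<forall>z\<in>M. cinner q z = 0)"
  then have "q - p \<in> M"
    using complex_vector.subspace_diff[OF M p(1), of "x - q"] by simp
  then have "cinner (q - p) (q - p) = 0"
    using p(2) q by (simp add: cinner.diff_left)
  then show "q = p"
    by (simp add: cinner_self_eq_0_iff)
qed (use p in blast)

lemma
  fixes M :: "'a::complex_hilbert set"
  assumes M: "complex_vector.subspace M" "closed M"
  shows diff_perp_part_mem: "x - perp_part M x \<in> M"
    and cinner_perp_part: "z \<in> M \<Longrightarrow> cinner (perp_part M x) z = 0"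
proof -
  obtain y where y: "y \<in> M" "\<And>z. z \<in> M \<Longrightarrow> cinner (x - y) z = 0"
    using ex_orthogonal_decomposition[OF M] by blast
  then have "perp_part M x = x - y"
    by (intro perp_part_eqI[OF M(1)]) auto
  with y show "x - perp_part M x \<in> M" "z \<in> M \<Longrightarrow> cinner (perp_part M x) z = 0"
    by auto
qed

text \<open>Sums and multiples of orthogonal decompositions are again such decompositions, so
  uniqueness gives linearity.\<close>

lemma clinear_on_perp_part:
  fixes M :: "'a::complex_hilbert set"
  assumes M: "complex_vector.subspace M" "closed M"
  shows "clinear_on B (perp_part M)"
  unfolding clinear_on_def
proof (intro conjI ballI allI)
  fix x y c
  have "(x - perp_part M x) + (y - perp_part M y) \<in> M"
    "c *\<^sub>C (x - perp_part M x) \<in> M"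
    by (intro complex_vector.subspace_add[OF M(1)] complex_vector.subspace_scale[OF M(1)]
        diff_perp_part_mem[OF M])+
  then show "perp_part M (x + y) = perp_part M x + perp_part M y"
    "perp_part M (c *\<^sub>C x) = c *\<^sub>C perp_part M x"
    by (auto intro!: perp_part_eqI[OF M(1)] simp: cinner_add_left cinner_scaleC_left
        cinner_perp_part[OF M] complex_vector.scale_right_diff_distrib algebra_simps)
qed

section \<open>Baire category and uniform boundedness\<close>

lemma closed_Baire:
  fixes A :: "'a::complete_space set" and E :: "nat \<Rightarrow> 'a set"
  assumes "closed A" "A \<noteq> {}" "A \<subseteq> (\<Union>n. E n)"
    and E: "\<And>n. closedin (top_of_set A) (E n)"
  obtains n x r where "x \<in> A" "r > 0" "ball x r \<inter> A \<subseteq> E n"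
proof -
  \<comment> \<open>A closed subset of a complete space is itself completely metrizable, so Baire's
    theorem applies in the relative topology.\<close>
  have "completely_metrizable_space (top_of_set A)"
    using completely_metrizable_space_closedin[OF completely_metrizable_space_euclidean, of A] \<open>closed A\<close>
    by simp
  have False if "\<And>n. top_of_set A interior_of E n = {}"
  proof -
    have "top_of_set A interior_of \<Union>(range E) = {}"
      by (rule Baire_category_alt) (use E that \<open>completely_metrizable_space (top_of_set A)\<close> in auto)
    moreover have "\<Union>(range E) = A"
      using assms(3) closedin_imp_subset[OF E] by auto
    ultimately show False
      using \<open>A \<noteq> {}\<close> interior_of_topspace[of "top_of_set A"] by simp
  qed
  then obtain n x where "x \<in> top_of_set A interior_of E n"
    by blast
  then obtain T where T: "openin (top_of_set A) T" "x \<in> T" "T \<subseteq> E n"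
    by (auto simp: interior_of_def)
  then obtain r where "r > 0" "ball x r \<inter> A \<subseteq> T" "x \<in> A"
    unfolding openin_contains_ball by (metis subsetD)
  then show thesis
    using that T by blast
qed

text \<open>A form of the uniform boundedness principle in which \<open>g\<close> is tested against
  vectors of its own range, exactly the functionals that Green's identity will control.\<close>

lemma weakly_bounded_imp_bounded:
  fixes A :: "'a::complex_hilbert set" and g :: "'a \<Rightarrow> 'b::complex_inner"
  assumes A: "complex_vector.subspace A" "closed A" and g: "clinear_on A g"
    and weak: "\<And>h. h \<in> g ` A \<Longrightarrow> \<exists>K. \<forall>u\<in>A. cmod (cinner (g u) h) \<le> K * norm u"
  obtains C where "C \<ge> 0" "\<And>u. u \<in> A \<Longrightarrow> norm (g u) \<le> C * norm u"
proof -
  define E where "E n = {u \<in> A. norm (g u) \<le> real n}" for n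
  have "closed (E n)" for n
    unfolding closed_sequential_limits
  proof (intro allI impI)
    fix s l assume s: "(\<forall>k. s k \<in> E n) \<and> s \<longlonglongrightarrow> l"
    then have sA: "s k \<in> A" "norm (g (s k)) \<le> n" for k
      by (auto simp: E_def)
    have l: "l \<in> A"
      using s sA(1) A(2) closed_sequentially by blast
    then obtain K where K: "\<And>u. u \<in> A \<Longrightarrow> cmod (cinner (g u) (g l)) \<le> K * norm u"
      using weak by blast
    \<comment> \<open>Testing against \<open>g l\<close> itself gives lower semicontinuity: the weak
      bound makes the contribution of \<open>g (l - s k)\<close> vanish in the limit.\<close>
    have "(norm (g l))\<^sup>2 \<le> n * norm (g l) + K * norm (l - s k)" for k
    proof -
      have "(norm (g l))\<^sup>2 = cmod (cinner (g l) (g l))"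
        unfolding cinner_self norm_of_real by simp
      also have "\<dots> = cmod (cinner (g (s k)) (g l) + cinner (g (l - s k)) (g l))"
        by (simp add: clinear_on_diff[OF g A(1) l sA(1)] cinner.diff_left)
      also have "\<dots> \<le> cmod (cinner (g (s k)) (g l)) + cmod (cinner (g (l - s k)) (g l))"
        by (rule norm_triangle_ineq)
      also have "\<dots> \<le> n * norm (g l) + K * norm (l - s k)"
        using K[OF complex_vector.subspace_diff[OF A(1) l sA(1)[of k]]]
          cmod_cinner_le_norm[of "g (s k)" "g l"] mult_right_mono[OF sA(2)[of k] norm_ge_zero[of "g l"]]
        by linarith
      finally show ?thesis .
    qed
    moreover have "(\<lambda>k. n * norm (g l) + K * norm (l - s k)) \<longlonglongrightarrow> n * norm (g l) + K * norm (l - l)"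
      using s by (intro tendsto_intros) auto
    ultimately have "(norm (g l))\<^sup>2 \<le> n * norm (g l)"
      by (intro LIMSEQ_le_const[where X = "\<lambda>k. n * norm (g l) + K * norm (l - s k)"]) auto
    then have "norm (g l) \<le> n"
      by (cases "norm (g l) = 0") (auto simp: power2_eq_square)
    with l show "l \<in> E n"
      by (simp add: E_def)
  qed
  then have "closedin (top_of_set A) (E n)" for n
    by (intro closed_subset) (auto simp: E_def)
  moreover have "A \<subseteq> (\<Union>n. E n)"
    by (auto simp: E_def intro: real_arch_simple)
  moreover have "A \<noteq> {}"
    using complex_vector.subspace_0[OF A(1)] by blast
  ultimately obtain n x r where x: "x \<in> A" "r > 0" "ball x r \<inter> A \<subseteq> E n"
    using closed_Baire[OF A(2)] by metis
  show thesis
  proof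
    show "norm (g u) \<le> (4 * real n / r) * norm u" if u: "u \<in> A" for u
    proof (cases "u = 0")
      case False
      \<comment> \<open>Scaling \<open>u\<close> to length \<open>r / 2\<close> keeps
        \<open>x + t *\<^sub>C u\<close> in the ball. This point and \<open>x\<close> both lie in
        \<open>E n\<close>, so their images differ by at most \<open>2 * n\<close>, whence the
        constant \<open>4 * n / r\<close>.\<close>
      define t where "t = complex_of_real (r / (2 * norm u))"
      have t: "t *\<^sub>C u \<in> A" "norm (t *\<^sub>C u) = r / 2"
        using u False \<open>r > 0\<close>
        by (auto simp: t_def norm_scaleC norm_divide norm_mult intro: complex_vector.subspace_scale[OF A(1)])
      have "x + t *\<^sub>C u \<in> ball x r \<inter> A" "x \<in> ball x r \<inter> A"
        using x t by (auto simp: dist_norm intro: complex_vector.subspace_add[OF A(1)])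
      then have "norm (g (x + t *\<^sub>C u)) \<le> n" "norm (g x) \<le> n"
        using subsetD[OF x(3)] unfolding E_def by blast+
      moreover have "g (x + t *\<^sub>C u) = g x + t *\<^sub>C g u"
        using g x(1) t(1) u unfolding clinear_on_def by simp
      ultimately have "norm (t *\<^sub>C g u) \<le> 2 * n"
        using norm_triangle_ineq4[of "g (x + t *\<^sub>C u)" "g x"] by simp
      then show ?thesis
        using False \<open>r > 0\<close> by (simp add: t_def norm_scaleC norm_divide norm_mult field_simps)
    qed (simp add: clinear_on_zero[OF g A(1)])
  qed (use x in simp)
qed

section \<open>Boundary maps on the skew complement of an isotropic subspace\<close>

text \<open>The form \<open>cinner (J u) v\<close> is skew-Hermitian and vanishes on
  \<open>\<Gamma>\<close>. In the application \<open>J\<close> is \<open>graph_rotation\<close> and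
  \<open>\<Gamma>\<close> is the closure of the graph of \<open>S\<close>.\<close>

locale isotropic_subspace =
  fixes J :: "'w::complex_hilbert \<Rightarrow> 'w" and \<Gamma> :: "'w set"
  assumes subspace_\<Gamma>: "complex_vector.subspace \<Gamma>" and closed_\<Gamma>: "closed \<Gamma>"
    and cinner_J_J: "cinner (J u) (J v) = cinner u v" and J_J: "J (J u) = - u"
    and isotropic: "u \<in> \<Gamma> \<Longrightarrow> v \<in> \<Gamma> \<Longrightarrow> cinner (J u) v = 0"
begin

definition skew_complement :: "'w set" where
  "skew_complement = {v. \<forall>u\<in>\<Gamma>. cinner (J u) v = 0}"

lemma subset_skew_complement: "\<Gamma> \<subseteq> skew_complement"
  using isotropic by (auto simp: skew_complement_def)

lemma subspace_skew_complement: "complex_vector.subspace skew_complement"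
  by (rule complex_vector.subspaceI)
     (auto simp: skew_complement_def cinner.zero_right cinner_add_right cinner_scaleC_right)

lemma closed_skew_complement: "closed skew_complement"
proof -
  have "skew_complement = (\<Inter>u\<in>\<Gamma>. {v. cinner (J u) v = 0})"
    by (auto simp: skew_complement_def)
  then show ?thesis
    by (auto intro!: closed_INT closed_Collect_eq cinner.continuous_on continuous_intros)
qed

lemma norm_J: "norm (J u) = norm u"
  by (simp add: norm_eq_sqrt_cinner cinner_J_J)

text \<open>Since \<open>J\<close> preserves inner products, \<open>J p\<close> is orthogonal to
  \<open>J u\<close> as soon as \<open>p\<close> is orthogonal to \<open>u\<close>.\<close>

lemma J_mem_skew_complement:
  assumes "\<And>z. z \<in> \<Gamma> \<Longrightarrow> cinner p z = 0"
  shows "J p \<in> skew_complement"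
  unfolding skew_complement_def mem_Collect_eq cinner_J_J
  using assms by (metis cinner_commute complex_cnj_zero)

text \<open>The first equation is the definition; the second holds because \<open>J_J\<close> makes
  the form skew-Hermitian.\<close>

lemma skew_zero:
  assumes "u \<in> \<Gamma>" "v \<in> skew_complement"
  shows "cinner (J u) v = 0" "cinner (J v) u = 0"
proof -
  show uv: "cinner (J u) v = 0"
    using assms by (simp add: skew_complement_def)
  have "cinner (J v) u = cinner (J (J v)) (J u)"
    by (simp only: cinner_J_J)
  also have "\<dots> = - cinner v (J u)"
    by (simp add: J_J cinner.minus_left)
  also have "\<dots> = 0"
    using uv by (metis cinner_commute complex_cnj_zero neg_equal_0_iff_equal)
  finally show "cinner (J v) u = 0" .
qed

text \<open>Meant for both boundary maps: exchanging them only reverses the sign in Green's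
  identity, which the unimodular \<open>c\<close> absorbs.\<close>

lemma boundary_map_bounded_complete:
  fixes G :: "'w \<Rightarrow> 'b::complex_inner" and K :: "'w \<Rightarrow> 'c::complex_inner"
  defines "A \<equiv> skew_complement"
  assumes G: "clinear_on A G" and K: "clinear_on A K" and c: "cmod c = 1"
    and green: "\<And>u v. u \<in> A \<Longrightarrow> v \<in> A \<Longrightarrow>
      cinner (J u) v = c * (cinner (G u) (G v) - cinner (K u) (K v))"
    and ker: "\<And>u. u \<in> A \<Longrightarrow> \<exists>x\<in>A. \<exists>y\<in>A. u = x + y \<and> K x = 0 \<and> G y = 0"
  shows "(\<exists>C\<ge>0. \<forall>u\<in>A. norm (G u) \<le> C * norm u) \<and> complete (G ` A)"
proof -
  have A: "complex_vector.subspace A" "closed A"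
    by (simp_all add: A_def subspace_skew_complement closed_skew_complement)
  \<comment> \<open>The kernel sum condition lets every value of \<open>G\<close> be attained on the
    kernel of \<open>K\<close>, where the \<open>K\<close> term of Green's identity drops
    out.\<close>
  have lift_G: "\<exists>v\<in>A. K v = 0 \<and> G v = G u" if u: "u \<in> A" for u
  proof -
    obtain x y where xy: "x \<in> A" "y \<in> A" "u = x + y" "K x = 0" "G y = 0"
      using ker[OF u] by blast
    then have "G x = G u"
      using G unfolding clinear_on_def by simp
    with xy show ?thesis
      by blast
  qed
  \<comment> \<open>The form vanishes when one argument is in \<open>\<Gamma>\<close>. Testing with
    \<open>v\<close> such that \<open>G v = G u\<close> and \<open>K v = 0\<close> gives
    \<open>cinner (G u) (G u) = 0\<close>; testing with \<open>u\<close> itself then disposes of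
    \<open>K u\<close>.\<close>
  have \<Gamma>_zero: "G u = 0" "K u = 0" if u: "u \<in> \<Gamma>" for u
  proof -
    have uA: "u \<in> A"
      using u subset_skew_complement by (auto simp: A_def)
    have eq: "cinner (G u) (G v) = cinner (K u) (K v)" if "v \<in> A" for v
      using green[OF uA that] skew_zero(1)[OF u] that c by (auto simp: A_def)
    obtain v where "v \<in> A" "K v = 0" "G v = G u"
      using lift_G[OF uA] by blast
    with eq[of v] show "G u = 0"
      by (simp add: cinner.zero_right cinner_self_eq_0_iff)
    then show "K u = 0"
      using eq[OF uA] by (simp add: cinner.zero_right cinner_self_eq_0_iff)
  qed
  obtain C where C: "C \<ge> 0" "\<And>u. u \<in> A \<Longrightarrow> norm (G u) \<le> C * norm u"
  proof (rule weakly_bounded_imp_bounded[OF A G])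
    fix h assume "h \<in> G ` A"
    then obtain v where v: "v \<in> A" "K v = 0" "G v = h"
      using lift_G by force
    \<comment> \<open>As \<open>h = G v\<close> and \<open>K v = 0\<close>, Green's identity turns
      \<open>cinner (G u) h\<close> into the bounded functional \<open>cinner (J u) v\<close>, up to
      a unimodular factor.\<close>
    have "cmod (cinner (G u) h) \<le> norm v * norm u" if "u \<in> A" for u
    proof -
      have "cmod (cinner (G u) h) = cmod (cinner (J u) v)"
        using green[OF that v(1)] v c by (simp add: cinner.zero_right norm_mult)
      also have "\<dots> \<le> norm v * norm u"
        using cmod_cinner_le_norm[of "J u" v] by (simp add: norm_J mult.commute)
      finally show ?thesis .
    qed
    then show "\<exists>K. \<forall>u\<in>A. cmod (cinner (G u) h) \<le> K * norm u"
      by blast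
  qed blast
  define L where "L = {v \<in> A. K v = 0 \<and> (\<forall>z\<in>\<Gamma>. cinner v z = 0)}"
  \<comment> \<open>Testing Green's identity with \<open>u = J v\<close> makes \<open>G\<close> bounded below on \<open>L\<close>.\<close>
  have L_norm: "norm v \<le> C * norm (G v)" if "v \<in> L" for v
  proof -
    have v: "v \<in> A" "K v = 0" and Jv: "J v \<in> A"
      using that J_mem_skew_complement by (auto simp: L_def A_def)
    have "(norm v)\<^sup>2 = cmod (cinner (J (J v)) v)"
      unfolding J_J cinner.minus_left norm_minus_cancel cinner_self norm_of_real by simp
    also have "\<dots> = cmod (cinner (G (J v)) (G v))"
      using green[OF Jv v(1)] v(2) c by (simp add: cinner.zero_right norm_mult)
    also have "\<dots> \<le> norm (G (J v)) * norm (G v)"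
      by (rule cmod_cinner_le_norm)
    also have "\<dots> \<le> C * norm v * norm (G v)"
      using C(2)[OF Jv] by (intro mult_right_mono) (simp_all add: norm_J)
    finally have "norm v * norm v \<le> norm v * (C * norm (G v))"
      by (simp add: power2_eq_square mult_ac)
    then show ?thesis
      using C(1) by (cases "norm v = 0") auto
  qed
  \<comment> \<open>Subtracting the component in \<open>\<Gamma>\<close> changes neither
    \<open>G\<close> nor \<open>K\<close>, as both vanish there, so a lift can be made orthogonal to
    \<open>\<Gamma>\<close>.\<close>
  have L_lift: "\<exists>v\<in>L. G v = h" if h: "h \<in> G ` A" for h
  proof -
    obtain u where u: "u \<in> A" "K u = 0" "G u = h"
      using lift_G h by force
    let ?p = "perp_part \<Gamma> u"
    have d: "u - ?p \<in> \<Gamma>"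
      by (rule diff_perp_part_mem[OF subspace_\<Gamma> closed_\<Gamma>])
    then have dA: "u - ?p \<in> A"
      using subset_skew_complement by (auto simp: A_def)
    have p: "?p = u - (u - ?p)"
      by simp
    have "?p \<in> A"
      by (subst p) (rule complex_vector.subspace_diff[OF A(1) u(1) dA])
    moreover have "K ?p = 0" "G ?p = h"
      using clinear_on_diff[OF K A(1) u(1) dA] clinear_on_diff[OF G A(1) u(1) dA] \<Gamma>_zero[OF d] u
      by simp_all
    ultimately show ?thesis
      using cinner_perp_part[OF subspace_\<Gamma> closed_\<Gamma>] by (auto simp: L_def)
  qed
  have "complete (G ` A)"
    unfolding complete_def
  proof (intro allI impI)
    fix f assume f: "(\<forall>n. f n \<in> G ` A) \<and> Cauchy f"
    \<comment> \<open>The sequence is lifted to \<open>L\<close>, which is closed under differences,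
      so \<open>L_norm\<close> makes the lifts Cauchy in the closed set \<open>A\<close>.\<close>
    then have "\<forall>n. \<exists>v. v \<in> L \<and> G v = f n"
      using L_lift by blast
    then obtain s where s: "\<And>n. s n \<in> L" "\<And>n. G (s n) = f n"
      by metis
    have sA: "s n \<in> A" for n
      using s(1) by (simp add: L_def)
    have diff: "norm (s m - s n) \<le> C * norm (f m - f n)" for m n
    proof -
      have "s m - s n \<in> L"
        using s(1)[of m] s(1)[of n] clinear_on_diff[OF K A(1) sA sA, of m n]
          complex_vector.subspace_diff[OF A(1) sA sA, of m n]
        by (simp add: L_def cinner.diff_left)
      then show ?thesis
        using L_norm[of "s m - s n"] clinear_on_diff[OF G A(1) sA sA, of m n] s(2) by simp
    qed
    have "Cauchy s"
    proof (rule metric_CauchyI)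
      fix e :: real assume "e > 0"
      \<comment> \<open>\<open>C + 1\<close> avoids a division by zero when
        \<open>C = 0\<close>.\<close>
      then have "e / (C + 1) > 0"
        using C(1) by simp
      then obtain N where N: "\<And>m n. m \<ge> N \<Longrightarrow> n \<ge> N \<Longrightarrow> dist (f m) (f n) < e / (C + 1)"
        using f unfolding Cauchy_def by blast
      have "dist (s m) (s n) < e" if "m \<ge> N" "n \<ge> N" for m n
      proof -
        have "dist (s m) (s n) \<le> (C + 1) * dist (f m) (f n)"
          using diff[of m n] mult_right_mono[of C "C + 1" "dist (f m) (f n)"]
          by (simp add: dist_norm)
        also have "\<dots> < e"
          using N[OF that] C(1) by (simp add: field_simps)
        finally show ?thesis .
      qed
      then show "\<exists>N. \<forall>m\<ge>N. \<forall>n\<ge>N. dist (s m) (s n) < e"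
        by blast
    qed
    then obtain l where l: "s \<longlonglongrightarrow> l"
      using Cauchy_convergent convergent_def by blast
    have lA: "l \<in> A"
      using A(2) sA l closed_sequentially by blast
    have "f \<longlonglongrightarrow> G l"
    proof (rule LIM_zero_cancel, rule tendsto_0_le)
      show "(\<lambda>n. s n - l) \<longlonglongrightarrow> 0"
        using l by (rule LIM_zero)
      show "\<forall>\<^sub>F n in sequentially. norm (f n - G l) \<le> norm (s n - l) * C"
        using C(2)[OF complex_vector.subspace_diff[OF A(1) sA lA]] clinear_on_diff[OF G A(1) sA lA] s(2)
        by (simp add: mult.commute)
    qed
    with lA show "\<exists>l\<in>G ` A. f \<longlonglongrightarrow> l"
      by blast
  qed
  with C show ?thesis
    by blast
qed

end

section \<open>The graph of the adjoint\<close>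

text \<open>The sign is chosen so that \<open>cinner (graph_rotation (u, T u)) (v, T v)\<close>
  equals \<open>cinner (T u) v - cinner u (T v)\<close>, the left side of Green's identity.\<close>

definition graph_rotation :: "'a::complex_inner \<times> 'a \<Rightarrow> 'a \<times> 'a" where
  "graph_rotation z = (snd z, - fst z)"

text \<open>For densely defined symmetric \<open>S\<close> this is the graph of its closure, kept as
  a set of pairs.\<close>

definition operator_closure :: "'a::complex_inner set \<Rightarrow> ('a \<Rightarrow> 'a) \<Rightarrow> ('a \<times> 'a) set" where
  "operator_closure D S = closure ((\<lambda>x. (x, S x)) ` D)"

lemma closed_cinner_graph_rotation:
  "closed {u. cinner (graph_rotation u) v = 0}" "closed {v. cinner (graph_rotation u) v = 0}"
  unfolding graph_rotation_def
  by (intro closed_Collect_eq cinner.continuous_on continuous_intros)+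

lemma isotropic_subspace_operator_closure:
  fixes S :: "'v::complex_hilbert \<Rightarrow> 'v"
  assumes "symmetric_operator D S"
  shows "isotropic_subspace graph_rotation (operator_closure D S)"
proof
  let ?\<Gamma> = "(\<lambda>x. (x, S x)) ` D"
  have D: "complex_vector.subspace D" and S: "clinear_on D S"
    and sym: "\<And>u v. u \<in> D \<Longrightarrow> v \<in> D \<Longrightarrow> cinner (S u) v = cinner u (S v)"
    using assms by (auto simp: symmetric_operator_def linear_operator_def)
  have "clinear_on D (\<lambda>x. (x, S x))"
    using S by (auto simp: clinear_on_def)
  then show "complex_vector.subspace (operator_closure D S)"
    unfolding operator_closure_def by (intro subspace_closure subspace_clinear_image D)
  show "closed (operator_closure D S)"
    by (simp add: operator_closure_def)
  fix u v :: "'v \<times> 'v"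
  show "cinner (graph_rotation u) (graph_rotation v) = cinner u v"
    by (simp add: graph_rotation_def cinner_prod_def cinner.minus_left cinner.minus_right)
  show "graph_rotation (graph_rotation u) = - u"
    by (simp add: graph_rotation_def prod_eq_iff)
  assume uv: "u \<in> operator_closure D S" "v \<in> operator_closure D S"
  \<comment> \<open>On the graph itself, isotropy is the symmetry of \<open>S\<close>. It passes to
    the closure in the second argument first, for a fixed graph element, and then in the
    first.\<close>
  have *: "cinner (graph_rotation x) v = 0" if "x \<in> ?\<Gamma>" for x
  proof -
    have "?\<Gamma> \<subseteq> {v. cinner (graph_rotation x) v = 0}"
      using that sym by (auto simp: graph_rotation_def cinner.minus_left)
    from closure_minimal[OF this closed_cinner_graph_rotation(2)] show ?thesis
      using uv(2) by (auto simp: operator_closure_def)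
  qed
  then have "?\<Gamma> \<subseteq> {u. cinner (graph_rotation u) v = 0}"
    by blast
  from closure_minimal[OF this closed_cinner_graph_rotation(1)] show "cinner (graph_rotation u) v = 0"
    using uv(1) by (auto simp: operator_closure_def)
qed

text \<open>Against graph elements, the orthogonality condition is the defining equation of the
  adjoint. Closing the graph adds no condition because the form is continuous, and density makes
  \<open>w\<close> unique.\<close>

lemma skew_complement_operator_closure:
  fixes S :: "'v::complex_hilbert \<Rightarrow> 'v"
  assumes sym: "symmetric_operator D S" and dd: "densely_defined D"
  shows "(v, w) \<in> isotropic_subspace.skew_complement graph_rotation (operator_closure D S)
    \<longleftrightarrow> v \<in> adj_dom D S \<and> w = adj D S v"
proof -
  interpret isotropic_subspace graph_rotation "operator_closure D S"
    by (rule isotropic_subspace_operator_closure[OF sym])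
  have "(v, w) \<in> skew_complement \<longleftrightarrow> operator_closure D S \<subseteq> {u. cinner (graph_rotation u) (v, w) = 0}"
    by (auto simp: skew_complement_def)
  also have "\<dots> \<longleftrightarrow> (\<lambda>x. (x, S x)) ` D \<subseteq> {u. cinner (graph_rotation u) (v, w) = 0}"
    unfolding operator_closure_def
    by (intro iffI closure_minimal closed_cinner_graph_rotation(1))
       (erule order_trans[OF closure_subset])
  also have "\<dots> \<longleftrightarrow> (\<forall>u\<in>D. cinner (S u) v = cinner u w)"
    by (auto simp: graph_rotation_def cinner.minus_left)
  also have "\<dots> \<longleftrightarrow> v \<in> adj_dom D S \<and> w = adj D S v"
    using adj_eqI[OF dd, of S v] unfolding adj_dom_def mem_Collect_eq by metis
  finally show ?thesis .
qed

text \<open>The graph of the adjoint is a skew complement, hence a subspace, and linearity is read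
  off from that.\<close>

lemma linear_operator_adj:
  fixes S :: "'v::complex_hilbert \<Rightarrow> 'v"
  assumes sym: "symmetric_operator D S" and dd: "densely_defined D"
  shows "linear_operator (adj_dom D S) (adj D S)"
proof -
  interpret isotropic_subspace graph_rotation "operator_closure D S"
    by (rule isotropic_subspace_operator_closure[OF sym])
  note mem = skew_complement_operator_closure[OF sym dd]
  note sub = subspace_skew_complement
  have "x + y \<in> adj_dom D S \<and> adj D S (x + y) = adj D S x + adj D S y"
    if "x \<in> adj_dom D S" "y \<in> adj_dom D S" for x y
    using complex_vector.subspace_add[OF sub, of "(x, adj D S x)" "(y, adj D S y)"] that by (simp add: mem)
  moreover have "c *\<^sub>C x \<in> adj_dom D S \<and> adj D S (c *\<^sub>C x) = c *\<^sub>C adj D S x"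
    if "x \<in> adj_dom D S" for c x
    using complex_vector.subspace_scale[OF sub, of "(x, adj D S x)" c] that by (simp add: mem)
  moreover have "0 \<in> adj_dom D S"
    using complex_vector.subspace_0[OF sub] by (simp add: mem zero_prod_def)
  ultimately show ?thesis
    by (simp add: linear_operator_def clinear_on_def complex_vector.subspace_def)
qed

lemma norm_graph: "norm (u, adj D S u) = graph_norm D S u"
  by (simp add: graph_norm_def norm_Pair)

text \<open>By linearity the bound is a Lipschitz estimate for the metric behind
  \<open>graph_topology\<close>.\<close>

lemma graph_bounded_imp_continuous_map:
  fixes S :: "'v::complex_inner \<Rightarrow> 'v" and G :: "'v \<Rightarrow> 'b::complex_inner"
  assumes dd: "densely_defined D" and sub: "complex_vector.subspace (adj_dom D S)"
    and G: "clinear_on (adj_dom D S) G"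
    and C: "C \<ge> 0" "\<And>u. u \<in> adj_dom D S \<Longrightarrow> norm (G u) \<le> C * graph_norm D S u"
  shows "continuous_map (graph_topology D S) (top_of_set (G ` adj_dom D S)) G"
proof -
  interpret Metric_space "adj_dom D S" "\<lambda>u v. graph_norm D S (u - v)"
    by (rule Metric_space_graph_norm[OF dd])
  have "continuous_map mtopology Met_TC.mtopology G"
    unfolding metric_continuous_map[OF Met_TC.Metric_space_axioms]
  proof (intro conjI ballI allI impI)
    fix a and e :: real assume a: "a \<in> adj_dom D S" and "e > 0"
    show "\<exists>d>0. \<forall>x. x \<in> adj_dom D S \<and> graph_norm D S (a - x) < d \<longrightarrow> dist (G a) (G x) < e"
    proof (intro exI conjI allI impI)
      show "e / (C + 1) > 0"
        using C(1) \<open>e > 0\<close> by simp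
      fix x assume x: "x \<in> adj_dom D S \<and> graph_norm D S (a - x) < e / (C + 1)"
      have "dist (G a) (G x) \<le> C * graph_norm D S (a - x)"
        using x C(2)[OF complex_vector.subspace_diff[OF sub a]] clinear_on_diff[OF G sub a]
        by (simp add: dist_norm)
      also have "\<dots> \<le> (C + 1) * graph_norm D S (a - x)"
        by (intro mult_right_mono) simp_all
      also have "\<dots> < e"
        using x C(1) by (simp add: field_simps)
      finally show "dist (G a) (G x) < e" .
    qed
  qed simp
  then show ?thesis
    by (auto simp: graph_topology_def continuous_map_in_subtopology)
qed

section \<open>Existence of a boundary quadruple\<close>

lemma ex_boundary_quadruple:
  fixes D :: "'v::complex_hilbert set" and S :: "'v \<Rightarrow> 'v"
  assumes sym: "symmetric_operator D S" and dd: "densely_defined D"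
  shows "\<exists>(Hm :: 'v set) (Hp :: 'v set) Gm Gp. boundary_quadruple D S Hm Hp Gm Gp"
proof -
  let ?\<Gamma> = "operator_closure D S" and ?A = "adj_dom D S" and ?T = "adj D S"
  interpret isotropic_subspace graph_rotation ?\<Gamma>
    by (rule isotropic_subspace_operator_closure[OF sym])
  note mem = skew_complement_operator_closure[OF sym dd]
  have A: "complex_vector.subspace ?A" and T: "clinear_on ?A ?T"
    using linear_operator_adj[OF sym dd] by (auto simp: linear_operator_def)
  define P where "P u = perp_part ?\<Gamma> (u, ?T u)" for u
  define p where "p u = fst (P u)" for u
  define q where "q u = snd (P u)" for u
  have "clinear_on ?A P"
    using T clinear_on_perp_part[OF subspace_\<Gamma> closed_\<Gamma>, of UNIV]
    unfolding clinear_on_def P_def by (metis UNIV_I add_Pair scaleC_Pair)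
  then have p: "clinear_on ?A p" and q: "clinear_on ?A q"
    by (simp_all add: clinear_on_def p_def q_def scaleC_prod_def)
  \<comment> \<open>The pair \<open>(p u, q u)\<close> lies in the graph of the adjoint and is
    orthogonal to \<open>\<Gamma>\<close>. Rotation preserves both properties, which yields the
    statements about \<open>(q u, - p u)\<close>.\<close>
  have pq: "p u \<in> ?A" "?T (p u) = q u" "q u \<in> ?A" "?T (q u) = - p u"
    and \<Gamma>_u: "(u, ?T u) - (p u, q u) \<in> ?\<Gamma>"
    and perp: "\<And>z. z \<in> ?\<Gamma> \<Longrightarrow> cinner (p u, q u) z = 0" "\<And>z. z \<in> ?\<Gamma> \<Longrightarrow> cinner (q u, - p u) z = 0"
    if u: "u \<in> ?A" for u
  proof -
    have Pu: "P u = (p u, q u)"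
      by (simp add: p_def q_def)
    show d: "(u, ?T u) - (p u, q u) \<in> ?\<Gamma>"
      unfolding Pu[symmetric] unfolding P_def by (rule diff_perp_part_mem[OF subspace_\<Gamma> closed_\<Gamma>])
    show perp: "cinner (p u, q u) z = 0" if "z \<in> ?\<Gamma>" for z
      unfolding Pu[symmetric] unfolding P_def by (rule cinner_perp_part[OF subspace_\<Gamma> closed_\<Gamma> that])
    have "(u, ?T u) \<in> skew_complement"
      using u by (simp add: mem)
    from complex_vector.subspace_diff[OF subspace_skew_complement this subsetD[OF subset_skew_complement d]]
    have mem_p: "(p u, q u) \<in> skew_complement"
      by simp
    have "graph_rotation (p u, q u) \<in> skew_complement"
      using perp by (rule J_mem_skew_complement)
    with mem_p show "p u \<in> ?A" "?T (p u) = q u" "q u \<in> ?A" "?T (q u) = - p u"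
      by (auto simp: mem graph_rotation_def)
    show "cinner (q u, - p u) z = 0" if "z \<in> ?\<Gamma>" for z
      using skew_zero(2)[OF that mem_p] by (simp add: graph_rotation_def)
  qed
  \<comment> \<open>This factor cancels the 2 left over when the cross terms of \<open>Gm\<close>
    and \<open>Gp\<close> are subtracted in Green's identity.\<close>
  define r where "r = complex_of_real (1 / sqrt 2)"
  have r: "r * (r * x) = x / 2" "cnj r = r" for x
    by (simp_all add: r_def flip: of_real_mult mult.assoc)
  \<comment> \<open>By the relations in \<open>pq\<close>, on the domain \<open>Gm u\<close> is in
    the eigenspace of the adjoint for \<open>\<i>\<close> and \<open>Gp u\<close> in the one for
    \<open>- \<i>\<close>.\<close>
  define Gm where "Gm u = r *\<^sub>C (p u - \<i> *\<^sub>C q u)" for u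
  define Gp where "Gp u = r *\<^sub>C (p u + \<i> *\<^sub>C q u)" for u
  have Gm: "clinear_on ?A Gm" and Gp: "clinear_on ?A Gp"
    using p q unfolding clinear_on_def Gm_def Gp_def
    by (simp_all add: algebra_simps scaleC_scaleC scaleC_add_right complex_vector.scale_right_diff_distrib)
  have green: "cinner (?T u) v - cinner u (?T v) = \<i> * (cinner (Gm u) (Gm v) - cinner (Gp u) (Gp v))"
    if u: "u \<in> ?A" and v: "v \<in> ?A" for u v
  proof -
    have memu: "(u, ?T u) \<in> skew_complement" and memv: "(p v, q v) \<in> skew_complement"
      using u pq[OF v] by (simp_all add: mem)
    have "cinner (?T u) v - cinner u (?T v) = cinner (graph_rotation (u, ?T u)) (v, ?T v)"
      by (simp add: graph_rotation_def cinner.minus_left)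
    \<comment> \<open>The components in \<open>\<Gamma>\<close> are dropped one argument at a time;
      the other argument is in the skew complement each time.\<close>
    also have "\<dots> = cinner (graph_rotation (u, ?T u)) (p v, q v)"
      using skew_zero(2)[OF \<Gamma>_u[OF v] memu] by (simp add: cinner_diff_right del: diff_Pair)
    also have "\<dots> = cinner (graph_rotation (p u, q u)) (p v, q v)"
      using skew_zero(1)[OF \<Gamma>_u[OF u] memv]
      by (simp add: graph_rotation_def cinner.diff_left cinner.minus_left algebra_simps)
    also have "\<dots> = \<i> * (cinner (Gm u) (Gm v) - cinner (Gp u) (Gp v))"
      by (simp add: graph_rotation_def Gm_def Gp_def cinner_scaleC_left cinner_scaleC_right r
          cinner.add_left cinner.add_right cinner.diff_left cinner.diff_right cinner.minus_left
          algebra_simps)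
    finally show ?thesis .
  qed
  have ker: "\<exists>x\<in>ker_on ?A Gp. \<exists>y\<in>ker_on ?A Gm. u = x + y" if u: "u \<in> ?A" for u
  proof -
    \<comment> \<open>The part of \<open>p u\<close> in the eigenspace of the adjoint for
      \<open>- \<i>\<close>: it is killed by \<open>Gm\<close> and has the same value under
      \<open>Gp\<close> as \<open>u\<close>.\<close>
    define y where "y = (1/2) *\<^sub>C (p u + \<i> *\<^sub>C q u)"
    have y: "y \<in> ?A"
      unfolding y_def
      by (intro complex_vector.subspace_add[OF A] complex_vector.subspace_scale[OF A] pq[OF u])
    have Ty: "?T y = (1/2) *\<^sub>C (q u - \<i> *\<^sub>C p u)"
      using T pq[OF u] complex_vector.subspace_add[OF A] complex_vector.subspace_scale[OF A]
      by (simp add: y_def clinear_on_def)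
    have "P y = (y, ?T y)"
      unfolding P_def
    proof (rule perp_part_eqI[OF subspace_\<Gamma>])
      show "(y, ?T y) - (y, ?T y) \<in> ?\<Gamma>"
        using complex_vector.subspace_0[OF subspace_\<Gamma>] by simp
      \<comment> \<open>Both pairs on the right are orthogonal to \<open>\<Gamma>\<close>, the
        second being the rotation of the first, so \<open>(y, ?T y)\<close> is its own perpendicular
        part.\<close>
      have "(y, ?T y) = (1/2) *\<^sub>C ((p u, q u) + \<i> *\<^sub>C (q u, - p u))"
        by (simp add: Ty) (simp add: y_def)
      then show "cinner (y, ?T y) z = 0" if "z \<in> ?\<Gamma>" for z
        using perp[OF u that] by (simp only: cinner_scaleC_left cinner_add_left) simp
    qed
    then have pqy: "p y = y" "q y = ?T y"
      by (simp_all add: p_def q_def)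
    have "Gm y = 0"
      by (simp add: Gm_def pqy Ty)
         (simp add: y_def algebra_simps scaleC_scaleC scaleC_add_right complex_vector.scale_right_diff_distrib)
    moreover have "p u + \<i> *\<^sub>C q u = y + \<i> *\<^sub>C ?T y"
    proof -
      have "y + \<i> *\<^sub>C ?T y = (1/2) *\<^sub>C (p u + \<i> *\<^sub>C q u) + (1/2) *\<^sub>C (p u + \<i> *\<^sub>C q u)"
        by (simp add: Ty)
           (simp add: y_def algebra_simps scaleC_scaleC scaleC_add_right complex_vector.scale_right_diff_distrib)
      also have "\<dots> = p u + \<i> *\<^sub>C q u"
        by (simp only: scaleC_add_left[symmetric]) (simp add: scaleC_one)
      finally show ?thesis ..
    qed
    then have "Gp (u - y) = 0"
      using clinear_on_diff[OF Gp A u y] by (simp add: Gp_def pqy)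
    ultimately show ?thesis
      using y complex_vector.subspace_diff[OF A u y] unfolding ker_on_def
      by (intro bexI[of _ "u - y"] bexI[of _ y]) auto
  qed
  have "{x + y |x y. x \<in> ker_on ?A Gp \<and> y \<in> ker_on ?A Gm} = ?A"
    using ker complex_vector.subspace_add[OF A] unfolding ker_on_def by blast
  then have "boundary_quadruple D S (Gm ` ?A) (Gp ` ?A) Gm Gp"
    unfolding boundary_quadruple_def
    using subspace_clinear_image[OF Gm A] subspace_clinear_image[OF Gp A] Gm Gp green
    by blast
  then show ?thesis
    by blast
qed

section \<open>Completeness and continuity for an arbitrary quadruple\<close>

lemma boundary_map_complete_continuous:
  fixes D :: "'v::complex_hilbert set" and S :: "'v \<Rightarrow> 'v"
    and G :: "'v \<Rightarrow> 'b::complex_inner" and K :: "'v \<Rightarrow> 'c::complex_inner"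
  assumes sym: "symmetric_operator D S" and dd: "densely_defined D"
    and G: "clinear_on (adj_dom D S) G" and K: "clinear_on (adj_dom D S) K" and c: "cmod c = 1"
    and green: "\<And>u v. u \<in> adj_dom D S \<Longrightarrow> v \<in> adj_dom D S \<Longrightarrow>
      cinner (adj D S u) v - cinner u (adj D S v) = c * (cinner (G u) (G v) - cinner (K u) (K v))"
    and ker: "\<And>u. u \<in> adj_dom D S \<Longrightarrow> \<exists>x\<in>ker_on (adj_dom D S) K. \<exists>y\<in>ker_on (adj_dom D S) G. u = x + y"
  shows "complete (G ` adj_dom D S)"
    and "continuous_map (graph_topology D S) (top_of_set (G ` adj_dom D S)) G"
proof -
  let ?A = "adj_dom D S" and ?T = "adj D S"
  interpret isotropic_subspace graph_rotation "operator_closure D S"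
    by (rule isotropic_subspace_operator_closure[OF sym])
  note mem = skew_complement_operator_closure[OF sym dd]
  have A: "complex_vector.subspace ?A" and T: "clinear_on ?A ?T"
    using linear_operator_adj[OF sym dd] by (auto simp: linear_operator_def)
  have fst_in: "fst z \<in> ?A \<and> snd z = ?T (fst z)" if "z \<in> skew_complement" for z
    using that mem[of "fst z" "snd z"] by simp
  \<comment> \<open>Composition with \<open>fst\<close> moves the boundary maps to the graph of the
    adjoint, where the norm of a pair is the graph norm of its first entry.\<close>
  have *: "(\<exists>C\<ge>0. \<forall>u\<in>skew_complement. norm ((G \<circ> fst) u) \<le> C * norm u)
      \<and> complete ((G \<circ> fst) ` skew_complement)"
  proof (rule boundary_map_bounded_complete[where K = "K \<circ> fst", OF _ _ c])
    show "clinear_on skew_complement (G \<circ> fst)" "clinear_on skew_complement (K \<circ> fst)"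
      using G K fst_in by (auto simp: clinear_on_def scaleC_prod_def)
    show "cinner (graph_rotation u) v
        = c * (cinner ((G \<circ> fst) u) ((G \<circ> fst) v) - cinner ((K \<circ> fst) u) ((K \<circ> fst) v))"
      if "u \<in> skew_complement" "v \<in> skew_complement" for u v
      using green[of "fst u" "fst v"] fst_in that
      by (simp add: graph_rotation_def cinner_prod_def cinner.minus_left)
    show "\<exists>x\<in>skew_complement. \<exists>y\<in>skew_complement. u = x + y \<and> (K \<circ> fst) x = 0 \<and> (G \<circ> fst) y = 0"
      if u: "u \<in> skew_complement" for u
    proof -
      obtain x y where xy: "x \<in> ?A" "y \<in> ?A" "K x = 0" "G y = 0" "fst u = x + y"
        using ker[of "fst u"] fst_in[OF u] by (auto simp: ker_on_def)
      then have "u = (x, ?T x) + (y, ?T y)"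
        using fst_in[OF u] T by (simp add: prod_eq_iff clinear_on_def)
      with xy show ?thesis
        by (intro bexI[of _ "(x, ?T x)"] bexI[of _ "(y, ?T y)"]) (auto simp: mem)
    qed
  qed
  moreover have "fst ` skew_complement = ?A"
  proof
    show "fst ` skew_complement \<subseteq> ?A"
      using fst_in by blast
    have "fst (u, ?T u) \<in> fst ` skew_complement" if "u \<in> ?A" for u
      using that by (intro imageI) (simp add: mem)
    then show "?A \<subseteq> fst ` skew_complement"
      by auto
  qed
  ultimately show "complete (G ` ?A)"
    by (metis image_comp)
  from * obtain C where "C \<ge> 0" "\<And>u. u \<in> skew_complement \<Longrightarrow> norm (G (fst u)) \<le> C * norm u"
    by auto
  then have "norm (G u) \<le> C * graph_norm D S u" if "u \<in> ?A" for u
    using that mem[of u "?T u"] by (force simp flip: norm_graph)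
  with \<open>C \<ge> 0\<close> show "continuous_map (graph_topology D S) (top_of_set (G ` ?A)) G"
    by (intro graph_bounded_imp_continuous_map[OF dd A G])
qed

theorem proposition5p3:
  fixes D :: "'v::complex_hilbert set" and S :: "'v \<Rightarrow> 'v"
  assumes "symmetric_operator D S" and "densely_defined D"
  shows "(\<exists>(Hm :: 'v set) (Hp :: 'v set) (Gm :: 'v \<Rightarrow> 'v) (Gp :: 'v \<Rightarrow> 'v).
            boundary_quadruple D S Hm Hp Gm Gp) \<and>
         (\<forall>(Hm :: 'b::complex_inner set) (Hp :: 'c::complex_inner set) (Gm :: 'v \<Rightarrow> 'b) (Gp :: 'v \<Rightarrow> 'c).
            boundary_quadruple D S Hm Hp Gm Gp \<longrightarrow>
              complete Hm \<and> complete Hp \<and>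
              continuous_map (graph_topology D S) (top_of_set Hm) Gm \<and>
              continuous_map (graph_topology D S) (top_of_set Hp) Gp)"
proof (intro conjI[OF ex_boundary_quadruple[OF assms]] allI impI)
  fix Hm :: "'b set" and Hp :: "'c set" and Gm Gp
  let ?A = "adj_dom D S"
  assume bq: "boundary_quadruple D S Hm Hp Gm Gp"
  note bq = bq[unfolded boundary_quadruple_def]
  have H: "Gm ` ?A = Hm" "Gp ` ?A = Hp" and G: "clinear_on ?A Gm" "clinear_on ?A Gp"
    and ker: "{x + y |x y. x \<in> ker_on ?A Gp \<and> y \<in> ker_on ?A Gm} = ?A"
    using bq by - (elim conjE, assumption)+
  have green: "cinner (adj D S u) v - cinner u (adj D S v)
      = \<i> * (cinner (Gm u) (Gm v) - cinner (Gp u) (Gp v))" if "u \<in> ?A" "v \<in> ?A" for u v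
    using bq that by (elim conjE) (drule (1) bspec, drule (1) bspec, assumption)
  have ker_m: "\<exists>x\<in>ker_on ?A Gp. \<exists>y\<in>ker_on ?A Gm. u = x + y"
    and ker_p: "\<exists>x\<in>ker_on ?A Gm. \<exists>y\<in>ker_on ?A Gp. u = x + y" if u: "u \<in> ?A" for u
  proof -
    have "u \<in> {x + y |x y. x \<in> ker_on ?A Gp \<and> y \<in> ker_on ?A Gm}"
      using u by (simp only: ker)
    then obtain x y where xy: "u = x + y" "x \<in> ker_on ?A Gp" "y \<in> ker_on ?A Gm"
      by blast
    then show "\<exists>x\<in>ker_on ?A Gp. \<exists>y\<in>ker_on ?A Gm. u = x + y"
      by blast
    have "u = y + x"
      using xy(1) by (simp only: add.commute)
    with xy show "\<exists>x\<in>ker_on ?A Gm. \<exists>y\<in>ker_on ?A Gp. u = x + y"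
      by blast
  qed
  \<comment> \<open>For \<open>Gp\<close> the two maps exchange roles, so the scalar becomes
    \<open>- \<i>\<close>.\<close>
  have green': "cinner (adj D S u) v - cinner u (adj D S v)
      = - \<i> * (cinner (Gp u) (Gp v) - cinner (Gm u) (Gm v))" if "u \<in> ?A" "v \<in> ?A" for u v
    unfolding green[OF that] by (simp add: algebra_simps)
  have "complete (Gm ` ?A) \<and> continuous_map (graph_topology D S) (top_of_set (Gm ` ?A)) Gm"
    by (intro conjI; rule boundary_map_complete_continuous[OF assms G(1,2) _ green ker_m]) simp_all
  moreover have "complete (Gp ` ?A) \<and> continuous_map (graph_topology D S) (top_of_set (Gp ` ?A)) Gp"
    by (intro conjI; rule boundary_map_complete_continuous[OF assms G(2,1) _ green' ker_p]) simp_all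
  ultimately show "complete Hm \<and> complete Hp \<and>
      continuous_map (graph_topology D S) (top_of_set Hm) Gm \<and>
      continuous_map (graph_topology D S) (top_of_set Hp) Gp"
    unfolding H by blast
qed

end
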